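(* Let $\nu$ be a Borel probability measure on $\mathbb{R}$. If there exists a Borel subset $E\subset\mathbb{R}$ such that $\nu(E)>0$ and $\nu(E+k)=0$ for all $k\in\mathbb{Z}\setminus\{0\}$, then $\mathcal{Z}(\nu)=\emptyset$.
   Context: The Fourier transform is $\widehat{\nu}(\xi)=\int_{\mathbb{R}}e^{-2\pi i\xi x}\,d\nu(x)$, and the integral periodic zero set of $\nu$ is $\mathcal{Z}(\nu)=\{\xi\in\mathbb{R}:\widehat{\nu}(\xi+k)=0\text{ for all }k\in\mathbb{Z}\}$. Here $E+k=\{x+k:x\in E\}$. *)

theory Defs
  imports "HOL-Probability.Probability"
begin

definition fourier_transform :: "real measure \<Rightarrow> real \<Rightarrow> complex" where
  "fourier_transform \<nu> \<xi> =
     (CLINT x|\<nu>. exp (- (2 * complex_of_real pi * \<i> * complex_of_real \<xi> * complex_of_real x)))"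

definition integral_periodic_zero_set :: "real measure \<Rightarrow> real set" where
  "integral_periodic_zero_set \<nu> = {\<xi>. \<forall>k::int. fourier_transform \<nu> (\<xi> + of_int k) = 0}"

end

theory Submission
  imports Defs
begin

text \<open>If \<open>\<xi>\<close> lies in the integral periodic zero set, then the complex measure
  \<open>cis (- 2 \<pi> \<xi> x) d\<nu>(x)\<close> annihilates all characters \<open>cis (2 \<pi> k x)\<close>.  By Stone-Weierstrass and a
  monotone class argument it annihilates the indicator of every \<open>\<int>\<close>-periodic Borel set.  For a Borel
  set \<open>A \<subseteq> E \<inter> [n, n + 1)\<close>, its periodization coincides \<open>\<nu>\<close>-almost everywhere with \<open>A\<close>, because the
  nontrivial integer translates of \<open>E\<close> are null sets.  Hence the complex measure vanishes
  on every Borel subset of \<open>E\<close>, and as its density has modulus one, \<open>\<nu> E = 0\<close>.\<close>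

lemma integrable_mult_power_int_unimodular:
  fixes u w :: "'a \<Rightarrow> complex"
  assumes [measurable]: "u \<in> borel_measurable M"
    and u: "\<And>x. cmod (u x) = 1"
    and w: "integrable M w"
  shows "integrable M (\<lambda>x. w x * u x powi k)"
proof (rule Bochner_Integration.integrable_bound[OF w])
  have [measurable]: "w \<in> borel_measurable M"
    using w by auto
  show "(\<lambda>x. w x * u x powi k) \<in> borel_measurable M"
    unfolding power_int_def by measurable
qed (simp add: norm_mult norm_power_int u)

text \<open>On the unit circle conjugation is inversion, so multiplying the weight by a real linear
  function of \<open>u x\<close> only shifts the frequency \<open>k\<close> by one up and down. The
  weight \<open>w\<close> must stay arbitrary in the induction because products change it.\<close>

lemma annihilates_characters_times_polynomial:
  fixes u w :: "'a \<Rightarrow> complex"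
  assumes [measurable]: "u \<in> borel_measurable M"
    and u: "\<And>x. cmod (u x) = 1"
    and p: "real_polynomial_function p"
    and w: "integrable M w" "\<And>k::int. (LINT x|M. w x * u x powi k) = 0"
  shows "integrable M (\<lambda>x. w x * of_real (p (u x))) \<and>
    (\<forall>k::int. (LINT x|M. w x * of_real (p (u x)) * u x powi k) = 0)"
  using p w
proof (induction p arbitrary: w)
  case (linear f)
  have nz: "u x \<noteq> 0" for x
    using u[of x] by auto
  note int = integrable_mult_power_int_unimodular[OF assms(1,2) linear.prems(1)]
  \<comment> \<open>Chosen so that the real linear map \<open>f\<close> becomes
    \<open>z \<mapsto> 2 * Re (a * z)\<close>.\<close>
  define a where "a = Complex (f 1 / 2) (- f \<i> / 2)"
  have cnj: "cnj (u x) = u x powi (-1)" for x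
    using u[of x] by (simp add: power_int_minus divide_conv_cnj inverse_eq_divide)
  have f: "of_real (f z) = a * z + cnj a * cnj z" for z
  proof -
    have "f z = f (Re z *\<^sub>R 1 + Im z *\<^sub>R \<i>)"
      by (rule arg_cong[of _ _ f]) (simp add: complex_eq_iff)
    also have "\<dots> = Re z * f 1 + Im z * f \<i>"
      using linear.hyps by (simp add: bounded_linear.linear linear_add linear_scale)
    finally show ?thesis
      by (simp add: a_def complex_eq_iff)
  qed
  have eq: "w x * of_real (f (u x)) * u x powi k
    = a * (w x * u x powi (k + 1)) + cnj a * (w x * u x powi (k - 1))" for x and k :: int
    using nz[of x] power_int_add[of "u x" k 1] power_int_add[of "u x" k "-1"]
    by (simp add: f cnj algebra_simps)
  have "integrable M (\<lambda>x. w x * of_real (f (u x)) * u x powi k)" for k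
    unfolding eq by (intro Bochner_Integration.integrable_add integrable_mult_right int)
  from this[of 0] have "integrable M (\<lambda>x. w x * of_real (f (u x)))"
    by simp
  moreover have "(LINT x|M. w x * of_real (f (u x)) * u x powi k) = 0" for k
    unfolding eq by (simp add: int linear.prems(2))
  ultimately show ?case
    by simp
next
  case (const c)
  have "(LINT x|M. of_real c * (w x * u x powi k)) = 0" for k
    by (simp add: const)
  then show ?case
    using const by (simp add: mult_ac)
next
  case (add f g)
  note int = integrable_mult_power_int_unimodular[OF assms(1,2)]
  note IH = add.IH(1)[OF add.prems] add.IH(2)[OF add.prems]
  show ?case
    using IH by (simp add: distrib_left distrib_right int)
next
  \<comment> \<open>The hypothesis for \<open>f\<close> makes \<open>w x * f (u x)\<close> an
    admissible weight, to which the hypothesis for \<open>g\<close> then applies.\<close>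
  case (mult f g)
  then show ?case
    using mult.IH(2)[of "\<lambda>x. w x * of_real (f (u x))"] mult.IH(1)[OF mult.prems]
    by (simp add: mult.assoc)
qed

text \<open>Replacing \<open>f\<close> by a polynomial that is uniformly \<open>e\<close>-close on
  the circle changes the integral by at most \<open>e\<close> times the L1 norm of \<open>w\<close>,
  and the polynomial part integrates to 0.\<close>

lemma annihilates_characters_imp_continuous:
  fixes u w :: "'a \<Rightarrow> complex" and f :: "complex \<Rightarrow> real"
  assumes [measurable]: "u \<in> borel_measurable M"
    and u: "\<And>x. cmod (u x) = 1"
    and w: "integrable M w" "\<And>k::int. (LINT x|M. w x * u x powi k) = 0"
    and f: "continuous_on UNIV f"
  shows "(LINT x|M. w x * of_real (f (u x))) = 0"
proof -
  have [measurable]: "f \<in> borel_measurable borel" "w \<in> borel_measurable M"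
    using f w by (auto intro: borel_measurable_continuous_onI)
  define I where "I = (LINT x|M. norm (w x))"
  have I: "I \<ge> 0"
    by (simp add: I_def)
  have bound: "norm (LINT x|M. w x * of_real (f (u x))) \<le> e * I" if "e > 0" for e
  proof -
    obtain p where p: "real_polynomial_function p" "\<And>z. z \<in> sphere 0 1 \<Longrightarrow> \<bar>f z - p z\<bar> < e"
      using Stone_Weierstrass_real_polynomial_function[of "sphere 0 1" f e] \<open>e > 0\<close>
        continuous_on_subset[OF f] by auto
    have le: "norm (w x * of_real (f (u x) - p (u x))) \<le> e * norm (w x)" for x
      using mult_right_mono[of "\<bar>f (u x) - p (u x)\<bar>" e "norm (w x)"] p(2)[of "u x"] u[of x]
      by (simp add: norm_mult mult.commute del: of_real_diff)
    have [measurable]: "p \<in> borel_measurable borel"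
      using p(1) by (intro borel_measurable_continuous_onI)
        (simp add: continuous_on_polymonial_function real_polynomial_function_eq)
    have int: "integrable M (\<lambda>x. w x * of_real (f (u x) - p (u x)))"
      by (rule Bochner_Integration.integrable_bound[of M "\<lambda>x. e * norm (w x)"])
        (use le w \<open>e > 0\<close> in \<open>auto simp: abs_mult\<close>)
    note P = annihilates_characters_times_polynomial[OF assms(1,2) p(1) w]
    have "(LINT x|M. w x * of_real (f (u x)))
      = (LINT x|M. w x * of_real (f (u x) - p (u x)) + w x * of_real (p (u x)))"
      by (simp add: algebra_simps)
    also have "\<dots> = (LINT x|M. w x * of_real (f (u x) - p (u x)))"
      using P[THEN conjunct2, rule_format, of 0] P
      by (subst Bochner_Integration.integral_add[OF int]) simp_all
    also have "norm \<dots> \<le> (LINT x|M. norm (w x * of_real (f (u x) - p (u x))))"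
      by (rule integral_norm_bound)
    also have "\<dots> \<le> (LINT x|M. e * norm (w x))"
      using le w(1) int by (intro integral_mono integrable_norm) auto
    finally show ?thesis
      by (simp add: I_def)
  qed
  have "norm (LINT x|M. w x * of_real (f (u x))) \<le> 0 + e" if "e > 0" for e
  proof -
    \<comment> \<open>Dividing by \<open>I + 1\<close> instead of \<open>I\<close> covers the case
      \<open>I = 0\<close>.\<close>
    have "e / (I + 1) * I \<le> e"
      using that I by (simp add: field_simps)
    then show ?thesis
      using bound[of "e / (I + 1)"] that I by simp
  qed
  then have "norm (LINT x|M. w x * of_real (f (u x))) \<le> 0"
    by (rule field_le_epsilon)
  then show ?thesis
    by simp
qed

text \<open>Closed sets form an intersection-stable generator, and their indicators are limits of
  continuous functions with values in [0, 1]. Linearity and dominated convergence then give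
  complements and disjoint unions.\<close>

lemma annihilates_characters_imp_borel:
  fixes u w :: "'a \<Rightarrow> complex"
  assumes [measurable]: "u \<in> borel_measurable M"
    and u: "\<And>x. cmod (u x) = 1"
    and w: "integrable M w" "\<And>k::int. (LINT x|M. w x * u x powi k) = 0"
    and B: "B \<in> sets borel"
  shows "(LINT x|M. w x * indicator B (u x)) = 0"
proof -
  have [measurable]: "w \<in> borel_measurable M"
    using w by auto
  have int: "integrable M (\<lambda>x. w x * indicator B (u x))" if [measurable]: "B \<in> sets borel" for B
    by (rule Bochner_Integration.integrable_bound[OF w(1)]) (auto simp: indicator_def)
  have "Int_stable {C::complex set. closed C}" "{C::complex set. closed C} \<subseteq> Pow UNIV"
    by (auto simp: Int_stable_def)
  moreover have "B \<in> sigma_sets UNIV {C. closed C}"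
    using B by (simp add: borel_eq_closed)
  ultimately show ?thesis
  proof (induction rule: sigma_sets_induct_disjoint)
    case (basic C)
    then have C: "closed C" by simp
    show ?case
    \<comment> \<open>The empty set is split off because \<open>infdist z {}\<close> is 0 by
      convention, which would make the approximants below constantly 1.\<close>
    proof (cases "C = {}")
      case False
      define f where "f n z = max 0 (1 - real n * infdist z C)" for n z
      have cont: "continuous_on UNIV (f n)" for n
        unfolding f_def by (intro continuous_intros)
      then have [measurable]: "f n \<in> borel_measurable borel" for n
        by (intro borel_measurable_continuous_onI)
      have [measurable]: "C \<in> sets borel"
        using C by simp
      have "(\<lambda>n. LINT x|M. w x * of_real (f n (u x))) \<longlonglongrightarrow> (LINT x|M. w x * indicator C (u x))"
      proof (rule integral_dominated_convergence[where w = "\<lambda>x. norm (w x)"])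
        show "AE x in M. (\<lambda>n. w x * of_real (f n (u x))) \<longlonglongrightarrow> w x * indicator C (u x)"
        proof (rule AE_I2)
          fix x
          have "(\<lambda>n. f n z) \<longlonglongrightarrow> indicator C z" for z
          proof (cases "z \<in> C")
            case True
            then show ?thesis by (simp add: f_def)
          next
            case nin: False
            then have "infdist z C > 0"
              using C False infdist_pos_not_in_closed by blast
            then have "\<forall>\<^sub>F n in sequentially. 1 - real n * infdist z C \<le> 0"
              by real_asymp
            then have "\<forall>\<^sub>F n in sequentially. f n z = indicator C z"
              by eventually_elim (use nin in \<open>simp add: f_def\<close>)
            then show ?thesis
              by (rule tendsto_eventually)
          qed
          then have "(\<lambda>n. w x * of_real (f n (u x))) \<longlonglongrightarrow> w x * of_real (indicator C (u x))"
            by (intro tendsto_intros)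
          then show "(\<lambda>n. w x * of_real (f n (u x))) \<longlonglongrightarrow> w x * indicator C (u x)"
            by (simp add: indicator_def of_bool_def if_distrib cong: if_cong)
        qed
        show "AE x in M. norm (w x * of_real (f n (u x))) \<le> norm (w x)" for n
          by (auto simp: norm_mult f_def infdist_nonneg intro!: mult_left_le)
      qed (use w in auto)
      then show ?thesis
        by (simp add: annihilates_characters_imp_continuous[OF assms(1,2) w cont] LIMSEQ_const_iff)
    qed simp
  next
    case empty
    then show ?case by simp
  next
    case (compl B)
    then have B [measurable]: "B \<in> sets borel"
      by (simp add: borel_eq_closed)
    \<comment> \<open>The complement needs the integral of \<open>w\<close> itself to vanish, which
      is the case \<open>k = 0\<close> of the assumption.\<close>
    have "w x * indicator (UNIV - B) (u x) = w x - w x * indicator B (u x)" for x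
      by (auto simp: indicator_def)
    then show ?case
      using compl w(2)[of 0] int[OF B] w(1) by simp
  next
    case (union A)
    then have A: "range A \<subseteq> sets borel"
      by (simp add: borel_eq_closed)
    then have [measurable]: "A i \<in> sets borel" for i
      by auto
    then have [measurable]: "(\<Union>i. A i) \<in> sets borel"
      by blast
    have "(\<lambda>n. LINT x|M. (\<Sum>i<n. w x * indicator (A i) (u x))) \<longlonglongrightarrow>
        (LINT x|M. w x * indicator (\<Union>i. A i) (u x))"
    proof (rule integral_dominated_convergence[where w = "\<lambda>x. norm (w x)"])
      \<comment> \<open>By disjointness each partial sum is \<open>w\<close> times a single
        indicator, hence dominated by \<open>norm (w x)\<close>.\<close>
      have sums: "(\<Sum>i<n. w x * indicator (A i) (u x)) = w x * indicator (\<Union>i<n. A i) (u x)" for n x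
        using union.hyps(1)
        by (simp add: indicator_UN_disjoint disjoint_family_on_mono[of "{..<n}" UNIV] sum_distrib_left)
      show "AE x in M. (\<lambda>n. \<Sum>i<n. w x * indicator (A i) (u x)) \<longlonglongrightarrow> w x * indicator (\<Union>i. A i) (u x)"
        unfolding sums by (auto intro!: tendsto_intros LIMSEQ_indicator_UN)
      show "AE x in M. norm (\<Sum>i<n. w x * indicator (A i) (u x)) \<le> norm (w x)" for n
        unfolding sums by (auto simp: indicator_def)
      show "(\<lambda>x. w x * indicator (\<Union>i. A i) (u x)) \<in> borel_measurable M"
        by measurable
    qed (use w in auto)
    moreover have "(LINT x|M. (\<Sum>i<n. w x * indicator (A i) (u x))) = 0" for n
      by (subst Bochner_Integration.integral_sum) (simp_all add: int union.IH)
    ultimately show ?case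
      by (simp only: LIMSEQ_const_iff)
  qed
qed

text \<open>\<open>Arg2pi\<close> jumps across the positive real axis but takes its smallest value 0
  there, so its strict superlevel sets are open.\<close>

lemma borel_measurable_Arg2pi: "Arg2pi \<in> borel_measurable borel"
  by (intro borel_measurable_iff_greater[THEN iffD2] allI)
    (use open_Arg2pi2pi_gt in simp)

text \<open>This inverts the covering of the circle by the line modulo integers, so that a Borel set
  within one period can be described by a Borel condition on the circle variable.\<close>

lemma Arg2pi_cis: "Arg2pi (cis (2 * pi * x)) = 2 * pi * frac x"
proof (rule Arg2pi_unique[of 1])
  have "cis (2 * pi * x) = cis (2 * pi * frac x) * cis (2 * pi * of_int \<lfloor>x\<rfloor>)"
    by (simp add: cis_mult frac_def algebra_simps)
  then show "of_real 1 * exp (\<i> * of_real (2 * pi * frac x)) = cis (2 * pi * x)"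
    using cis_conv_exp[of "2 * pi * frac x"] by simp
  show "2 * pi * frac x < 2 * pi"
    using frac_lt_1[of x] by simp
qed auto

theorem theorem1p2:
  fixes \<nu> :: "real measure"
  assumes "real_distribution \<nu>"
    and "\<exists>E \<in> sets borel. measure \<nu> E > 0 \<and>
           (\<forall>k::int. k \<noteq> 0 \<longrightarrow> measure \<nu> ((\<lambda>x. x + of_int k) ` E) = 0)"
  shows "integral_periodic_zero_set \<nu> = {}"
proof (rule ccontr)
  interpret real_distribution \<nu> by fact
  assume "integral_periodic_zero_set \<nu> \<noteq> {}"
  then obtain \<xi> where \<xi>: "fourier_transform \<nu> (\<xi> + of_int k) = 0" for k
    by (auto simp: integral_periodic_zero_set_def)
  obtain E where E_borel: "E \<in> sets borel" and pos: "measure \<nu> E > 0"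
    and E: "\<And>k::int. k \<noteq> 0 \<Longrightarrow> measure \<nu> ((\<lambda>x. x + of_int k) ` E) = 0"
    using assms(2) by blast
  note [measurable] = E_borel
  define u where "u x = cis (2 * pi * x)" for x
  define w where "w x = cis (- 2 * pi * \<xi> * x)" for x
  have [measurable]: "u \<in> borel_measurable \<nu>" "w \<in> borel_measurable \<nu>"
    unfolding u_def w_def measurable_cong_sets[OF events_eq_borel refl]
    by (auto intro!: borel_measurable_continuous_onI continuous_intros)
  have u: "cmod (u x) = 1" for x
    by (simp add: u_def)
  have w: "integrable \<nu> w"
    by (rule integrable_const_bound[of _ 1]) (auto simp: w_def)
  have w0: "(LINT x|\<nu>. w x * u x powi k) = 0" for k
  proof -
    \<comment> \<open>The product is the Fourier kernel at frequency \<xi> - k, hence the sign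
      change in \<open>k\<close>.\<close>
    have "w x * u x powi k
      = exp (- (2 * complex_of_real pi * \<i> * complex_of_real (\<xi> + of_int (- k)) * complex_of_real x))" for x
      unfolding u_def w_def cis_power_int cis_mult
      by (simp add: cis_conv_exp algebra_simps)
    then show ?thesis
      using \<xi>[of "- k"] by (simp add: fourier_transform_def)
  qed
  have translates: "AE x in \<nu>. \<forall>k\<in>UNIV - {0::int}. x - of_int k \<notin> E"
  proof (subst AE_ball_countable, simp, intro ballI)
    fix k :: int assume "k \<in> UNIV - {0}"
    have eq: "(\<lambda>x. x + of_int k) ` E = (\<lambda>x. x - of_int k) -` E"
      by (force simp: image_iff)
    have "(\<lambda>x. x - of_int k) -` E \<in> sets \<nu>"
      using measurable_sets_borel[OF _ E_borel, of "\<lambda>x. x - of_int k"] by simp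
    then have "(\<lambda>x. x - of_int k) -` E \<in> null_sets \<nu>"
      using E[of k] \<open>k \<in> UNIV - {0}\<close> by (simp add: null_sets_def eq emeasure_eq_measure)
    then show "AE x in \<nu>. x - of_int k \<notin> E"
      by (rule AE_I') auto
  qed
  \<comment> \<open>Cutting \<open>E\<close> into pieces of length one leaves at most one point of
    each class modulo the integers.\<close>
  have "AE x in \<nu>. x \<notin> E \<inter> {real_of_int n..<of_int n + 1}" for n
  proof -
    define F where "F = E \<inter> {real_of_int n..<of_int n + 1}"
    have [measurable]: "F \<in> sets borel"
      by (simp add: F_def)
    have "AE x in \<nu>. indicator F x *\<^sub>R w x = 0"
    proof (rule density_zero)
      show "integrable \<nu> (\<lambda>x. indicator F x *\<^sub>R w x)"
        by (intro integrable_mult_indicator w) simp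
      fix A assume "A \<in> sets \<nu>"
      then have [measurable]: "A \<in> sets borel"
        by simp
      \<comment> \<open>\<open>u x\<close> lies in \<open>B\<close> exactly when the representative
        of \<open>x\<close> modulo 1 in [n, n + 1) lies in \<open>A \<inter> F\<close>.\<close>
      define B where "B = {z. Arg2pi z / (2 * pi) + of_int n \<in> A \<inter> F}"
      note [measurable] = borel_measurable_Arg2pi
      have B [measurable]: "B \<in> sets borel"
        unfolding B_def by measurable
      have "AE x in \<nu>. indicator A x *\<^sub>R indicator F x *\<^sub>R w x = w x * indicator B (u x)"
        using translates
      proof eventually_elim
        case (elim x)
        have "u x \<in> B \<longleftrightarrow> x - of_int (\<lfloor>x\<rfloor> - n) \<in> A \<inter> F"
          by (simp add: B_def u_def Arg2pi_cis frac_def diff_diff_eq2 diff_add_eq)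
        also have "\<dots> \<longleftrightarrow> x \<in> A \<inter> F"
        proof (cases "\<lfloor>x\<rfloor> = n")
          \<comment> \<open>The representative differs from \<open>x\<close> by a nonzero integer,
            so \<open>elim\<close> keeps it out of \<open>E\<close>, while \<open>x\<close> itself
            is outside [n, n + 1): both sides are false.\<close>
          case False
          then have "x - of_int (\<lfloor>x\<rfloor> - n) \<notin> F"
            using bspec[OF elim, of "\<lfloor>x\<rfloor> - n"] by (simp add: F_def)
          moreover have "x \<notin> F"
            using False floor_unique[of n x] by (auto simp: F_def)
          ultimately show ?thesis by simp
        qed simp
        finally show ?case
          by (simp add: indicator_def)
      qed
      then have "(LINT x|\<nu>. indicator A x *\<^sub>R indicator F x *\<^sub>R w x) = (LINT x|\<nu>. w x * indicator B (u x))"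
        by (intro integral_cong_AE) measurable
      then show "set_lebesgue_integral \<nu> A (\<lambda>x. indicator F x *\<^sub>R w x) = 0"
        unfolding set_lebesgue_integral_def
        using annihilates_characters_imp_borel[OF _ u w w0 B] by simp
    qed
    \<comment> \<open>Since \<open>w\<close> has modulus one, it is the indicator of
      \<open>F\<close> that vanishes almost everywhere.\<close>
    then show ?thesis
      by eventually_elim (auto simp: w_def F_def indicator_def)
  qed
  then have "AE x in \<nu>. \<forall>n. x \<notin> E \<inter> {real_of_int n..<of_int n + 1}"
    by (simp add: AE_all_countable)
  then have "AE x in \<nu>. x \<notin> E"
  proof eventually_elim
    case (elim x)
    from elim[rule_format, of "\<lfloor>x\<rfloor>"] show ?case
      by auto
  qed
  then have "measure \<nu> E = 0"
    by (subst (asm) AE_iff_measurable[of E]) (auto simp: measure_def)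
  with pos show False
    by simp
qed

end
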